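(* For every integer $d\geq 1$ there exists a constant $c=c(d)>0$ such that the following holds. Let $P\subset \mathbb{R}^d$ be a set of $n\geq d^2+d+1$ points in general position. Then there exist a $d$-dimensional simplex $\Delta$ spanned by $P$ and a set of at least $c\binom{n}{d^2}$ subsets of $P$ of size $d^2$ such that each of these subsets $Q$ admits a Tverberg partition into $d$ sets $Q_1,\ldots,Q_d$ whose determined Tverberg point lies in $\Delta$.
   Context: A set $P\subset\mathbb{R}^d$ is in general position if no $d+1$ of its points lie in a hyperplane. For $S\subset P$ with $1\leq |S|\leq d+1$, $\mathrm{conv}(S)$ is the $(|S|-1)$-dimensional simplex spanned by $S$; a simplex is spanned by $P$ if it is spanned by some subset of $P$. The lexicographic order on $\mathbb{R}^d$: $x<_{\mathrm{lex}} y$ if for some $i$, $x_j=y_j$ for all $j<i$ and $x_i<y_i$; every nonempty compact set has a unique lexicographic minimum. A Tverberg partition of a set $Q$ of $d^2$ points into $d$ sets is a partition $Q=Q_1\cup\dots\cup Q_d$ with $\bigcap_{i=1}^d \mathrm{conv}(Q_i)\neq\emptyset$; the Tverberg point determined by this partition is the lexicographic minimum of $\bigcap_{i=1}^d \mathrm{conv}(Q_i)$. *)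

theory Defs
  imports "HOL-Analysis.Analysis" "HOL-Library.Disjoint_Sets"
begin

text \<open>
  Points of \<open>\<real>\<^sup>d\<close> are vectors of type \<^typ>\<open>real ^ 'd\<close> with \<open>d = CARD('d)\<close>. The index type is
  linearly ordered, so that the coordinates can be compared lexicographically.
\<close>

definition general_position :: "(real ^ 'd) set \<Rightarrow> bool" where
  "general_position P \<longleftrightarrow>
     (\<forall>S\<subseteq>P. card S = CARD('d) + 1 \<longrightarrow> \<not> (\<exists>a b. a \<noteq> 0 \<and> S \<subseteq> {x. a \<bullet> x = b}))"

definition spanned_by :: "(real ^ 'd) set \<Rightarrow> (real ^ 'd) set \<Rightarrow> bool" where
  "spanned_by \<Delta> P \<longleftrightarrow>
     (\<exists>S\<subseteq>P. 1 \<le> card S \<and> card S \<le> CARD('d) + 1 \<and> \<Delta> = convex hull S)"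

definition lex_less :: "(real, 'd::{finite,linorder}) vec \<Rightarrow> (real, 'd) vec \<Rightarrow> bool" (infix \<open><\<^sub>l\<^sub>e\<^sub>x\<close> 50) where
  "x <\<^sub>l\<^sub>e\<^sub>x y \<longleftrightarrow> (\<exists>i. (\<forall>j<i. x $ j = y $ j) \<and> x $ i < y $ i)"

definition is_lex_min :: "(real, 'd::{finite,linorder}) vec \<Rightarrow> (real, 'd) vec set \<Rightarrow> bool" where
  "is_lex_min x A \<longleftrightarrow> x \<in> A \<and> (\<forall>y\<in>A. y \<noteq> x \<longrightarrow> x <\<^sub>l\<^sub>e\<^sub>x y)"

text \<open>
  A partition into \<open>r\<close> sets is given by its set of parts, which are nonempty by
  \<^const>\<open>partition_on\<close>. This loses nothing, since an empty part would make the intersection of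
  the convex hulls empty.
\<close>

definition tverberg_partition :: "nat \<Rightarrow> (real ^ 'd) set \<Rightarrow> (real ^ 'd) set set \<Rightarrow> bool" where
  "tverberg_partition r Q \<Q> \<longleftrightarrow>
     partition_on Q \<Q> \<and> card \<Q> = r \<and> (\<Inter>X\<in>\<Q>. convex hull X) \<noteq> {}"

definition is_tverberg_point :: "(real, 'd::{finite,linorder}) vec \<Rightarrow> (real, 'd) vec set set \<Rightarrow> bool" where
  "is_tverberg_point p \<Q> \<longleftrightarrow> is_lex_min p (\<Inter>X\<in>\<Q>. convex hull X)"

end

theory Submission
  imports Defs
begin

text \<open>
  Among any \<open>d\<^sup>2 + d + 1\<close> points there are \<open>d\<^sup>2\<close> points with a Tverberg partition into \<open>d\<close> sets whose
  Tverberg point lies in the simplex spanned by the remaining \<open>d + 1\<close> points. Indeed, by Tverberg's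
  theorem the points split into \<open>d + 1\<close> classes, which may be taken of size at most \<open>d + 1\<close>, whose
  hulls have a common point. Let \<open>p\<close> be the lexicographic minimum of the intersection of the hulls.
  By Helly's theorem \<open>p\<close> is already the lexicographic minimum for \<open>d\<close> of the classes. As \<open>p\<close> is an
  extreme point of the intersection of these \<open>d\<close> hulls, the minimal faces of the hulls that contain
  \<open>p\<close> have at most \<open>d\<^sup>2\<close> vertices altogether, so a \<open>d\<^sup>2\<close>-element subset of the \<open>d\<close> classes with these
  vertices still has \<open>p\<close> as its Tverberg point, while its complement contains the remaining class.
  Averaging over all \<open>(d\<^sup>2 + d + 1)\<close>-subsets of \<open>P\<close>, some simplex occurs for a positive fraction of all
  \<open>d\<^sup>2\<close>-subsets.
\<close>

section \<open>Tverberg's theorem\<close>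

text \<open>\<open>f\<close> may repeat points, so all weight goes to a set \<open>J\<close> of
  representatives. Indexed weights are needed later because points selected for different colours
  may coincide.\<close>

lemma convex_hull_image_weights:
  fixes f :: "'i \<Rightarrow> 'a::real_vector"
  assumes "finite I" "p \<in> convex hull (f ` I)"
  obtains u where "\<And>i. i \<in> I \<Longrightarrow> 0 \<le> u i" "sum u I = 1" "(\<Sum>i\<in>I. u i *\<^sub>R f i) = p"
proof -
  obtain J where J: "J \<subseteq> I" "inj_on f J" "f ` I = f ` J"
    using subset_image_inj[of "f ` I" f I] by auto
  obtain w where w: "\<forall>x\<in>f ` J. 0 \<le> w x" "sum w (f ` J) = 1" "(\<Sum>x\<in>f ` J. w x *\<^sub>R x) = p"
    using assms J convex_hull_finite[of "f ` J"] finite_subset[OF J(1)] by auto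
  define u where "u i = (if i \<in> J then w (f i) else 0)" for i
  have "0 \<le> u i" for i
    using w(1) by (auto simp: u_def)
  moreover have "sum u I = sum (w \<circ> f) J"
    using assms(1) J(1) by (intro sum.mono_neutral_cong_right) (auto simp: u_def)
  then have "sum u I = 1"
    using w(2) J(2) by (simp add: sum.reindex)
  moreover have "(\<Sum>i\<in>I. u i *\<^sub>R f i) = (\<Sum>i\<in>J. w (f i) *\<^sub>R f i)"
    using assms(1) J(1) by (intro sum.mono_neutral_cong_right) (auto simp: u_def)
  then have "(\<Sum>i\<in>I. u i *\<^sub>R f i) = p"
    using w(3) J(2) by (simp add: sum.reindex o_def)
  ultimately show thesis
    using that by blast
qed

text \<open>Take a transversal whose hull is closest to the origin. If its closest point \<open>z\<close> is not \<open>0\<close>, it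
  lies in a proper face, so one colour is not needed to represent \<open>z\<close>; exchanging the point of
  that colour for one on the other side of the origin brings the hull closer.\<close>

theorem colourful_caratheodory:
  fixes M :: "'i \<Rightarrow> 'a::euclidean_space set"
  assumes I: "finite I" "DIM('a) < card I"
    and fin: "\<And>i. i \<in> I \<Longrightarrow> finite (M i)"
    and zero: "\<And>i. i \<in> I \<Longrightarrow> 0 \<in> convex hull (M i)"
  obtains m where "\<And>i. i \<in> I \<Longrightarrow> m i \<in> M i" "0 \<in> convex hull (m ` I)"
proof -
  \<comment> \<open>The distance from the origin to the hull of a transversal; it attains its
    minimum because there are only finitely many transversals.\<close>
  define f where "f m = norm (closest_point (convex hull (m ` I)) 0)" for m :: "'i \<Rightarrow> 'a"
  have "I \<noteq> {}"
    using I by auto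
  have finT: "finite (PiE I M)"
    using I fin by (simp add: finite_PiE)
  have "M i \<noteq> {}" if "i \<in> I" for i
    using zero[OF that] by auto
  then have neT: "PiE I M \<noteq> {}"
    by (simp add: PiE_eq_empty_iff)
  obtain m where m: "m \<in> PiE I M" and m_min: "\<And>m'. m' \<in> PiE I M \<Longrightarrow> f m \<le> f m'"
    using ex_min_if_finite[of "f ` PiE I M"] finT neT by (auto simp: not_less)
  define H where "H m = convex hull (m ` I)" for m :: "'i \<Rightarrow> 'a"
  have H: "convex (H m)" "closed (H m)" "H m \<noteq> {}" for m
    using I \<open>I \<noteq> {}\<close> by (auto simp: H_def compact_imp_closed compact_convex_hull finite_imp_compact)
  define z where "z = closest_point (H m) 0"
  have zH: "z \<in> H m"
    using H by (simp add: z_def closest_point_in_set)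
  have z_le: "z \<bullet> y \<ge> z \<bullet> z" if "y \<in> H m" for y
    using closest_point_dot[OF H(1,2) that, of 0] by (simp add: z_def inner_diff_right)
  have "z = 0"
  proof (rule ccontr)
    assume "z \<noteq> 0"
    have "(H m \<inter> {x. z \<bullet> x = z \<bullet> z}) face_of H m"
      by (rule face_of_Int_supporting_hyperplane_ge) (use H z_le in auto)
    then obtain S' where S': "S' \<subseteq> m ` I" "H m \<inter> {x. z \<bullet> x = z \<bullet> z} = convex hull S'"
      unfolding H_def using I
      by (elim face_of_convex_hull_subset[rotated]) (auto intro: finite_imp_compact)
    have "S' \<subseteq> {x. z \<bullet> x = z \<bullet> z}"
      using S'(2) hull_subset[of S' convex] by blast
    \<comment> \<open>The supporting hyperplane at \<open>z\<close> lowers the dimension by one, so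
      Caratheodory needs at most \<open>DIM('a)\<close> points for \<open>z\<close>, and some colour
      \<open>k\<close> is left over.\<close>
    then have "aff_dim S' \<le> int DIM('a) - 1"
      using \<open>z \<noteq> 0\<close> aff_dim_subset[of S' "{x. z \<bullet> x = z \<bullet> z}"] by simp
    moreover have "z \<in> convex hull S'"
      using S'(2) zH by blast
    then obtain S where S: "S \<subseteq> S'" "int (card S) \<le> aff_dim S' + 1" "z \<in> convex hull S"
      unfolding caratheodory_aff_dim[of S'] by blast
    ultimately have "card S \<le> DIM('a)"
      by linarith
    obtain J where J: "J \<subseteq> I" "inj_on m J" "S = m ` J"
      using S(1) S'(1) subset_image_inj[of S m I] by auto
    then have "card J < card I"
      using \<open>card S \<le> DIM('a)\<close> I(2) by (simp add: card_image)
    then obtain k where k: "k \<in> I" "k \<notin> J"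
      using J(1) by (metis less_irrefl subsetI subset_antisym)
    \<comment> \<open>Otherwise \<open>M k\<close> would lie in an open half-space that misses the
      origin.\<close>
    have "\<exists>y\<in>M k. z \<bullet> y \<le> 0"
    proof (rule ccontr)
      assume "\<not> ?thesis"
      then have "M k \<subseteq> {x. z \<bullet> x > 0}"
        by auto
      then have "convex hull (M k) \<subseteq> {x. z \<bullet> x > 0}"
        by (rule hull_minimal) (rule convex_halfspace_gt)
      then show False
        using zero[OF k(1)] by auto
    qed
    then obtain y where y: "y \<in> M k" "z \<bullet> y \<le> 0"
      by blast
    define m' where "m' = m(k := y)"
    have m': "m' \<in> PiE I M"
      using m y k by (auto simp: m'_def PiE_iff extensional_def)
    have "S \<subseteq> m' ` I"
      using J k by (auto simp: m'_def)
    then have zH': "z \<in> H m'"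
      using S(3) hull_mono unfolding H_def by blast
    have "m' k \<in> m' ` I"
      using k by blast
    then have yH': "y \<in> H m'"
      unfolding H_def by (simp add: m'_def hull_inc)
    have "norm z \<le> norm (closest_point (H m') 0)"
      using m_min[OF m'] by (simp add: f_def z_def H_def)
    \<comment> \<open>By minimality of \<open>m\<close>, \<open>z\<close> is also closest to the
      origin in \<open>H m'\<close>. The angle condition at \<open>y\<close> then gives
      \<open>z \<bullet> z \<le> z \<bullet> y \<le> 0\<close>.\<close>
    then have "\<forall>x\<in>H m'. dist 0 z \<le> dist 0 x"
      using closest_point_le[OF H(2), of _ m' 0] by (fastforce intro: order_trans)
    then have "(0 - z) \<bullet> (y - z) \<le> 0"
      by (rule any_closest_point_dot[OF H(1,2) zH' yH'])
    then have "z \<bullet> z \<le> 0"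
      using y(2) by (simp add: inner_diff_right)
    then show False
      using \<open>z \<noteq> 0\<close> inner_gt_zero_iff[of z] by linarith
  qed
  then show thesis
    using that[of m] m zH by (auto simp: H_def)
qed

lemma sum_UNIV_option:
  fixes f :: "'r::finite option \<Rightarrow> 'b::comm_monoid_add"
  shows "(\<Sum>c\<in>UNIV. f c) = f None + (\<Sum>i\<in>UNIV. f (Some i))"
  by (simp add: UNIV_option_conv sum.reindex)

text \<open>Sarkaria's argument: tensor the lifted points \<open>(x, 1)\<close> with the vectors \<open>e\<^sub>i\<close> and \<open>-\<Sum>e\<^sub>i\<close>,
  whose only linear relation is that they add up to \<open>0\<close>.\<close>

theorem tverberg:
  fixes X :: "'a::euclidean_space set"
  assumes X: "finite X" "CARD('r::finite) * (DIM('a) + 1) < card X"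
  obtains g :: "'a \<Rightarrow> 'r::finite option" and p where "\<And>c. p \<in> convex hull {x\<in>X. g x = c}"
proof -
  define v :: "'r option \<Rightarrow> real ^ 'r" where
    "v c = (case c of None \<Rightarrow> (\<chi> i. -1) | Some i \<Rightarrow> axis i 1)" for c
  have v_nth: "v c $ i = (if c = Some i then 1 else 0) - (if c = None then 1 else 0)" for c i
    by (auto simp: v_def axis_def split: option.split)
  define l :: "'a \<Rightarrow> 'r option \<Rightarrow> ('a \<times> real) ^ 'r" where
    "l x c = (\<chi> i. v c $ i *\<^sub>R (x, 1))" for x c
  have "0 \<in> convex hull range (l x)" for x
  proof -
    have "(\<Sum>c\<in>UNIV. (1 / CARD('r option)) *\<^sub>R l x c) \<in> convex hull range (l x)"
      by (rule convex_sum) (auto simp: hull_inc)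
    moreover have "(\<Sum>c\<in>UNIV. l x c) $ i = (\<Sum>c\<in>UNIV. v c $ i) *\<^sub>R (x, 1)" for i
      by (simp add: l_def scaleR_left.sum del: scaleR_Pair)
    then have "(\<Sum>c\<in>UNIV. l x c) = 0"
      by (simp add: vec_eq_iff sum_UNIV_option v_nth zero_prod_def)
    ultimately show ?thesis
      by (simp flip: scaleR_right.sum)
  qed
  \<comment> \<open>The tensor space has dimension \<open>CARD('r) * (DIM('a) + 1)\<close>, which is
    the bound in the hypothesis. Each point of \<open>X\<close> acts as a colour.\<close>
  moreover have "DIM(('a \<times> real) ^ 'r) < card X"
    using X(2) by simp
  ultimately obtain m where m: "\<And>x. x \<in> X \<Longrightarrow> m x \<in> range (l x)" "0 \<in> convex hull (m ` X)"
    using colourful_caratheodory[OF X(1), of "\<lambda>x. range (l x)"] by auto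
  then obtain g where g: "\<And>x. x \<in> X \<Longrightarrow> m x = l x (g x)"
    unfolding image_iff by metis
  obtain w where w: "\<And>x. x \<in> X \<Longrightarrow> 0 \<le> w x" "sum w X = 1" "(\<Sum>x\<in>X. w x *\<^sub>R m x) = 0"
    using convex_hull_image_weights[OF X(1) m(2)] by blast
  define A where "A c = (\<Sum>x | x \<in> X \<and> g x = c. w x *\<^sub>R (x, 1::real))" for c
  have A_eq: "A c = (\<Sum>x\<in>X. (if g x = c then 1 else 0) *\<^sub>R w x *\<^sub>R (x, 1::real))" for c
    unfolding A_def by (rule sum.mono_neutral_cong_left) (use X(1) in \<open>auto simp: zero_prod_def\<close>)
  \<comment> \<open>The difference of the two class sums is coordinate \<open>i\<close> of the
    vanishing combination.\<close>
  have A_Some: "A (Some i) = A None" for i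
  proof -
    have "A (Some i) - A None = (\<Sum>x\<in>X. v (g x) $ i *\<^sub>R w x *\<^sub>R (x, 1::real))"
      unfolding A_eq v_nth by (simp add: sum_subtractf scaleR_left_diff_distrib left_diff_distrib del: scaleR_Pair)
    also have "\<dots> = (\<Sum>x\<in>X. w x *\<^sub>R m x) $ i"
      by (simp add: g l_def mult.commute del: scaleR_Pair)
    finally show ?thesis
      using w(3) by simp
  qed
  then have A_const: "A c = A None" for c
    by (cases c) auto
  have "(\<Sum>c\<in>UNIV. A c) = (\<Sum>x\<in>X. w x *\<^sub>R (x, 1))"
    unfolding A_eq by (subst sum.swap) (simp flip: scaleR_left.sum sum_distrib_right del: scaleR_Pair)
  \<comment> \<open>The last coordinate of \<open>A c\<close> is the total weight of class
    \<open>c\<close>. These weights agree and add up to 1, so they are positive and normalising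
    gives one common point.\<close>
  then have "snd (\<Sum>c\<in>UNIV. A c) = 1"
    using w(2) by (simp add: snd_sum)
  moreover have "(\<Sum>c\<in>UNIV. A c) = (\<Sum>c\<in>(UNIV :: 'r option set). A None)"
    by (intro sum.cong A_const refl)
  ultimately have "real CARD('r option) * snd (A None) = 1"
    by (simp add: snd_sum del: card_option)
  then have pos: "snd (A None) > 0"
    by (smt (verit) mult_nonneg_nonpos of_nat_0_le_iff)
  define p where "p = fst (A None) /\<^sub>R snd (A None)"
  have "p \<in> convex hull {x\<in>X. g x = c}" for c
  proof -
    let ?Y = "{x \<in> X. g x = c}" and ?s = "snd (A None)"
    have s: "?s = sum w ?Y" and q: "fst (A None) = (\<Sum>x\<in>?Y. w x *\<^sub>R x)"
      unfolding A_const[of c, symmetric] by (simp_all add: A_def snd_sum fst_sum)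
    have "(\<Sum>x\<in>?Y. (w x / ?s) *\<^sub>R x) \<in> convex hull ?Y"
      by (rule convex_sum) (use X(1) w(1) pos in \<open>auto simp: hull_inc s simp flip: sum_divide_distrib\<close>)
    also have "(\<Sum>x\<in>?Y. (w x / ?s) *\<^sub>R x) = p"
      unfolding p_def q by (simp add: scaleR_right.sum divide_inverse mult.commute)
    finally show ?thesis .
  qed
  then show thesis
    using that by blast
qed

section \<open>Balancing the classes of a Tverberg partition\<close>

text \<open>Points of \<open>Z\<close> are added one at a time; before each insertion the total is
  strictly below capacity, so some class has room.\<close>

lemma extend_map_bounded_fibres:
  fixes g :: "'a \<Rightarrow> 'c::finite"
  assumes "finite Y" "Y \<inter> Z = {}" "finite Z"
    and "\<And>c. card {x\<in>Y. g x = c} \<le> m" "card (Y \<union> Z) \<le> m * CARD('c)"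
  obtains h where "\<And>x. x \<in> Y \<Longrightarrow> h x = g x" "\<And>c. card {x\<in>Y \<union> Z. h x = c} \<le> m"
proof -
  have "\<exists>h. (\<forall>x\<in>Y. h x = g x) \<and> (\<forall>c. card {x\<in>Y \<union> Z. h x = c} \<le> m)"
    using \<open>finite Z\<close> assms(2,5)
  proof (induction Z rule: finite_induct)
    case empty
    then show ?case
      using assms(4) by auto
  next
    case (insert z Z)
    have fin: "finite (Y \<union> Z)" and z: "z \<notin> Y \<union> Z"
      using assms(1) insert by auto
    have less: "card (Y \<union> Z) < m * CARD('c)"
      using insert.prems(2) fin z by simp
    then obtain h where h: "\<forall>x\<in>Y. h x = g x" "\<forall>c. card {x\<in>Y \<union> Z. h x = c} \<le> m"
      using insert by auto
    have "\<exists>c. card {x\<in>Y \<union> Z. h x = c} < m"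
    proof (rule ccontr)
      assume "\<not> ?thesis"
      then have ge: "m \<le> card {x\<in>Y \<union> Z. h x = c}" for c
        by (simp add: not_less)
      have "(\<Sum>c\<in>(UNIV :: 'c set). m) \<le> (\<Sum>c\<in>UNIV. card {x\<in>Y \<union> Z. h x = c})"
        by (rule sum_mono) (rule ge)
      also have "\<dots> = card (Y \<union> Z)"
        using sum.group[where T = UNIV and g = h and h = "\<lambda>_. 1::nat", OF fin] by simp
      finally show False
        using less by (simp add: mult.commute)
    qed
    then obtain c where c: "card {x\<in>Y \<union> Z. h x = c} < m"
      by blast
    have "{x \<in> Y \<union> insert z Z. (h(z := c)) x = c'} =
        (if c' = c then insert z {x\<in>Y \<union> Z. h x = c'} else {x\<in>Y \<union> Z. h x = c'})" for c'
      using z by auto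
    then have "card {x \<in> Y \<union> insert z Z. (h(z := c)) x = c'} \<le> m" for c'
      using c h(2) fin z by simp
    moreover have "\<forall>x\<in>Y. (h(z := c)) x = g x"
      using h(1) z by auto
    ultimately show ?case
      by blast
  qed
  then show thesis
    using that by blast
qed

text \<open>Caratheodory shrinks each class to at most \<open>DIM('a) + 1\<close> points that still
  capture \<open>p\<close>; the leftover points are then distributed within the capacity. The size
  bound ensures that dropping a class leaves enough points.\<close>

lemma balanced_tverberg:
  fixes X :: "'a::euclidean_space set"
  assumes X: "finite X" "CARD('r::finite) * (DIM('a) + 1) < card X"
    and le: "card X \<le> CARD('r option) * (DIM('a) + 1)"
  obtains g :: "'a \<Rightarrow> 'r::finite option" and p
  where "\<And>c. p \<in> convex hull {x\<in>X. g x = c}" "\<And>c. card {x\<in>X. g x = c} \<le> DIM('a) + 1"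
proof -
  obtain g :: "'a \<Rightarrow> 'r option" and p where g: "\<And>c. p \<in> convex hull {x\<in>X. g x = c}"
    using tverberg[OF X] by blast
  have "\<exists>D. D \<subseteq> {x\<in>X. g x = c} \<and> card D \<le> DIM('a) + 1 \<and> p \<in> convex hull D" for c
    using g[of c] unfolding caratheodory[of "{x\<in>X. g x = c}"] by blast
  then obtain D where D: "\<And>c. D c \<subseteq> {x\<in>X. g x = c}" "\<And>c. card (D c) \<le> DIM('a) + 1"
    "\<And>c. p \<in> convex hull D c"
    by metis
  let ?Y = "\<Union>c. D c"
  have Y: "?Y \<subseteq> X"
    using D(1) by blast
  have Dg: "{x\<in>?Y. g x = c} = D c" for c
    using D(1) by blast
  obtain h where h: "\<And>x. x \<in> ?Y \<Longrightarrow> h x = g x"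
    "\<And>c. card {x\<in>?Y \<union> (X - ?Y). h x = c} \<le> DIM('a) + 1"
  proof (rule extend_map_bounded_fibres[of ?Y "X - ?Y" g "DIM('a) + 1"])
    show "card (?Y \<union> (X - ?Y)) \<le> (DIM('a) + 1) * CARD('r option)"
      using Y le by (simp add: Un_absorb1 mult.commute)
    show "card {x\<in>?Y. g x = c} \<le> DIM('a) + 1" for c
      using D(2) by (simp only: Dg)
  qed (use X(1) finite_subset[OF Y X(1)] in blast)+
  have X_eq: "?Y \<union> (X - ?Y) = X"
    using Y by blast
  have "D c \<subseteq> {x\<in>X. h x = c}" for c
    using D(1) h(1) by fastforce
  then have "p \<in> convex hull {x\<in>X. h x = c}" for c
    using D(3) hull_mono by blast
  then show thesis
    using that h(2) unfolding X_eq by blast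
qed

section \<open>The lexicographic order\<close>

lemma lex_less_irrefl: "\<not> x <\<^sub>l\<^sub>e\<^sub>x x"
  by (simp add: lex_less_def)

lemma lex_less_asym:
  assumes "x <\<^sub>l\<^sub>e\<^sub>x y"
  shows "\<not> y <\<^sub>l\<^sub>e\<^sub>x x"
proof
  assume "y <\<^sub>l\<^sub>e\<^sub>x x"
  with assms obtain i j where "\<forall>k<i. x $ k = y $ k" "x $ i < y $ i"
    and "\<forall>k<j. y $ k = x $ k" "y $ j < x $ j"
    by (auto simp: lex_less_def)
  then show False
    by (cases i j rule: linorder_cases) auto
qed

lemma lex_less_linear:
  assumes "x \<noteq> y"
  shows "x <\<^sub>l\<^sub>e\<^sub>x y \<or> y <\<^sub>l\<^sub>e\<^sub>x x"
proof -
  define i where "i = Min {i. x $ i \<noteq> y $ i}"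
  have "{i. x $ i \<noteq> y $ i} \<noteq> {}"
    using assms by (auto simp: vec_eq_iff)
  then have "x $ i \<noteq> y $ i" "\<forall>j<i. x $ j = y $ j"
    using Min_in[of "{i. x $ i \<noteq> y $ i}"] Min_le[of "{i. x $ i \<noteq> y $ i}"]
    unfolding i_def[symmetric] by (auto simp: not_le[symmetric])
  then show ?thesis
    unfolding lex_less_def by (metis linorder_neqE_linordered_idom)
qed

lemma convex_lex_less: "convex {x. x <\<^sub>l\<^sub>e\<^sub>x p}"
proof (rule convexI)
  fix x y and u v :: real
  assume "x \<in> {x. x <\<^sub>l\<^sub>e\<^sub>x p}" "y \<in> {x. x <\<^sub>l\<^sub>e\<^sub>x p}"
  then obtain i j where i: "\<forall>k<i. x $ k = p $ k" "x $ i < p $ i"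
    and j: "\<forall>k<j. y $ k = p $ k" "y $ j < p $ j"
    by (auto simp: lex_less_def)
  assume uv: "0 \<le> u" "0 \<le> v" "u + v = 1"
  have p: "p $ k = u * p $ k + v * p $ k" for k
    using uv(3) by (simp flip: distrib_right)
  show "u *\<^sub>R x + v *\<^sub>R y \<in> {x. x <\<^sub>l\<^sub>e\<^sub>x p}"
  proof (cases "u = 0 \<or> v = 0")
    case True
    then show ?thesis
      using uv i j by (force simp: lex_less_def)
  next
    case False
    then have pos: "u > 0" "v > 0"
      using uv by auto
    \<comment> \<open>At the first index where \<open>x\<close> or \<open>y\<close> departs from
      \<open>p\<close>, neither is larger and at least one is strictly smaller.\<close>
    define k where "k = min i j"
    have "x $ k \<le> p $ k" "y $ k \<le> p $ k" "x $ k < p $ k \<or> y $ k < p $ k"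
      unfolding k_def using i j by (cases i j rule: linorder_cases; force)+
    then have "u * x $ k + v * y $ k < u * p $ k + v * p $ k"
      using pos by (smt (verit) mult_less_cancel_left_pos)
    moreover have "\<forall>l<k. u * x $ l + v * y $ l = p $ l"
      using i j p unfolding k_def by (metis min_less_iff_conj)
    ultimately show ?thesis
      using p by (auto simp: lex_less_def)
  qed
qed

text \<open>Coordinates are minimised one after another. Each inserted index \<open>b\<close>
  precedes all of \<open>A\<close>, so coordinate \<open>b\<close> is minimised first and the
  induction hypothesis is applied to the compact slice \<open>K'\<close>; hence \<open>K\<close>
  must be arbitrary.\<close>

lemma lex_min_exists:
  fixes K :: "(real ^ 'd::{finite,linorder}) set"
  assumes "compact K" "K \<noteq> {}"
  obtains x where "is_lex_min x K"
proof -
  have "\<exists>x\<in>K. \<forall>y\<in>K. (\<forall>i\<in>A. x $ i = y $ i) \<or>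
          (\<exists>i\<in>A. (\<forall>j\<in>A. j < i \<longrightarrow> x $ j = y $ j) \<and> x $ i < y $ i)" for A
    using finite[of A] assms
  proof (induction A arbitrary: K rule: finite_linorder_min_induct)
    case empty
    then show ?case by auto
  next
    case (insert b A)
    have cont: "continuous_on K (\<lambda>x. x $ b)"
      by (intro continuous_intros)
    obtain x0 where x0: "x0 \<in> K" "\<And>y. y \<in> K \<Longrightarrow> x0 $ b \<le> y $ b"
      using continuous_attains_inf[OF insert.prems cont] by blast
    define K' where "K' = K \<inter> {x. x $ b = x0 $ b}"
    have "closed {x :: (real, 'd) vec. x $ b = x0 $ b}"
      by (intro closed_Collect_eq continuous_intros)
    then have "compact K'" "K' \<noteq> {}"
      using insert.prems x0 by (auto simp: K'_def compact_Int_closed)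
    from insert.IH[OF this] obtain x where x: "x \<in> K'"
      "\<And>y. y \<in> K' \<Longrightarrow> (\<forall>i\<in>A. x $ i = y $ i) \<or>
          (\<exists>i\<in>A. (\<forall>j\<in>A. j < i \<longrightarrow> x $ j = y $ j) \<and> x $ i < y $ i)"
      by blast
    show ?case
    proof (intro bexI ballI)
      show "x \<in> K"
        using x by (simp add: K'_def)
      fix y assume "y \<in> K"
      show "(\<forall>i\<in>insert b A. x $ i = y $ i) \<or>
          (\<exists>i\<in>insert b A. (\<forall>j\<in>insert b A. j < i \<longrightarrow> x $ j = y $ j) \<and> x $ i < y $ i)"
      proof (cases "y \<in> K'")
        case True
        then have "x $ b = y $ b"
          using x by (simp add: K'_def)
        then show ?thesis
          using x(2)[OF True] by auto
      next
        case False
        then have "x $ b < y $ b"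
          using x(1) x0(2)[OF \<open>y \<in> K\<close>] \<open>y \<in> K\<close> by (auto simp: K'_def)
        moreover have "\<forall>j\<in>insert b A. \<not> j < b"
          using insert.hyps by auto
        ultimately show ?thesis
          by blast
      qed
    qed
  qed
  from this[of UNIV] obtain x where "x \<in> K"
    "\<forall>y\<in>K. (\<forall>i. x $ i = y $ i) \<or> (\<exists>i. (\<forall>j<i. x $ j = y $ j) \<and> x $ i < y $ i)"
    by auto
  then have "is_lex_min x K"
    by (auto simp: is_lex_min_def lex_less_def vec_eq_iff)
  then show thesis
    by (rule that)
qed

lemma is_lex_min_iff: "is_lex_min p A \<longleftrightarrow> p \<in> A \<and> A \<inter> {x. x <\<^sub>l\<^sub>e\<^sub>x p} = {}"
  using lex_less_linear lex_less_asym lex_less_irrefl by (fastforce simp: is_lex_min_def)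

text \<open>Helly's theorem applied to the given sets together with \<open>{x. x <\<^sub>l\<^sub>e\<^sub>x p}\<close>.\<close>

lemma lex_min_helly:
  fixes K :: "'i::finite \<Rightarrow> (real ^ 'd::{finite,linorder}) set"
  assumes card: "CARD('d) < CARD('i)"
    and conv: "\<And>i. convex (K i)"
    and p: "is_lex_min p (\<Inter>i. K i)"
  obtains j where "is_lex_min p (\<Inter>i\<in>-{j}. K i)"
proof -
  let ?L = "{x. x <\<^sub>l\<^sub>e\<^sub>x p}"
  have pK: "p \<in> K i" for i
    using p by (auto simp: is_lex_min_def)
  have "\<exists>j. (\<Inter>i\<in>-{j}. K i) \<inter> ?L = {}"
  \<comment> \<open>Helly is applied to a set of sets, so repetitions are treated apart: a repeated
    set can simply be dropped.\<close>
  proof (cases "inj K")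
    case False
    then obtain i j where "i \<noteq> j" "K i = K j"
      by (auto simp: inj_def)
    then have "(\<Inter>i\<in>-{j}. K i) = (\<Inter>i. K i)"
      by (auto; metis)
    then show ?thesis
      using p by (metis is_lex_min_iff)
  next
    case True
    let ?F = "insert ?L (range K)"
    have L: "?L \<notin> range K"
      using pK lex_less_irrefl by blast
    show ?thesis
    proof (rule ccontr)
      assume neg: "\<not> ?thesis"
      have "\<Inter>?F \<noteq> {}"
      proof (rule Helly)
        show "DIM((real, 'd) vec) + 1 \<le> card ?F"
          using L True card by (simp add: card_image)
        show "\<forall>s\<in>?F. convex s"
          using conv convex_lex_less by auto
        fix T assume T: "T \<subseteq> ?F" "card T = DIM((real, 'd) vec) + 1"
        show "\<Inter>T \<noteq> {}"
        proof (cases "?L \<in> T")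
          case False
          then have "p \<in> \<Inter>T"
            using T pK by blast
          then show ?thesis by blast
        next
          case LT: True
          \<comment> \<open>\<open>T\<close> has \<open>CARD('d) + 1\<close> members including
            \<open>?L\<close>, while \<open>range K\<close> alone has at least that many. So
            \<open>T\<close> misses some \<open>K j\<close>, and \<open>neg\<close> supplies a
            common point.\<close>
          have "\<not> range K \<subseteq> T"
          proof
            assume "range K \<subseteq> T"
            then have "card ?F \<le> card T"
              using LT T(1) by (intro card_mono) (auto intro: finite_subset)
            then show False
              using T(2) L True card by (simp add: card_image)
          qed
          then obtain j where "K j \<notin> T"
            by auto
          then have "(\<Inter>i\<in>-{j}. K i) \<inter> ?L \<subseteq> \<Inter>T"
            using T(1) by auto
          then show ?thesis
            using neg by blast
        qed
      qed
      then show False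
        using p by (auto simp: is_lex_min_iff)
    qed
  qed
  then show thesis
    using that pK by (auto simp: is_lex_min_iff)
qed

text \<open>Negation reverses the lexicographic order.\<close>

lemma convex_lex_greater: "convex {x. p <\<^sub>l\<^sub>e\<^sub>x x}"
proof -
  have "{x. p <\<^sub>l\<^sub>e\<^sub>x x} = uminus ` {x. x <\<^sub>l\<^sub>e\<^sub>x - p}"
  proof (intro set_eqI iffI)
    fix x assume "x \<in> {x. p <\<^sub>l\<^sub>e\<^sub>x x}"
    then have "- x <\<^sub>l\<^sub>e\<^sub>x - p"
      by (force simp: lex_less_def)
    then show "x \<in> uminus ` {x. x <\<^sub>l\<^sub>e\<^sub>x - p}"
      by (intro image_eqI[of _ _ "- x"]) auto
  qed (fastforce simp: lex_less_def)
  then show ?thesis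
    by (simp add: convex_negations convex_lex_less)
qed

text \<open>A segment whose endpoints both exceed \<open>p\<close> stays in the convex set of points
  above \<open>p\<close>, so it cannot pass through \<open>p\<close>.\<close>

lemma lex_min_extreme_point:
  assumes "is_lex_min p A"
  shows "p extreme_point_of A"
  unfolding extreme_point_of_def
proof (intro conjI ballI notI)
  show "p \<in> A"
    using assms by (simp add: is_lex_min_def)
  fix a b assume ab: "a \<in> A" "b \<in> A" "p \<in> open_segment a b"
  then have "a \<noteq> p" "b \<noteq> p"
    by (auto simp: open_segment_def)
  then have "{a, b} \<subseteq> {x. p <\<^sub>l\<^sub>e\<^sub>x x}"
    using assms ab by (auto simp: is_lex_min_def)
  then have "closed_segment a b \<subseteq> {x. p <\<^sub>l\<^sub>e\<^sub>x x}"
    unfolding segment_convex_hull by (rule hull_minimal) (rule convex_lex_greater)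
  then show False
    using ab(3) lex_less_irrefl by (auto simp: open_segment_def)
qed

section \<open>Simplices around an extreme point\<close>

text \<open>Take \<open>D\<close> of least cardinality. Caratheodory forces affine independence, and
  a zero weight would allow a smaller set, so all weights are positive.\<close>

lemma minimal_simplex_containing:
  fixes p :: "'a::euclidean_space"
  assumes "finite C" "p \<in> convex hull C"
  obtains D where "D \<subseteq> C" "\<not> affine_dependent D" "p \<in> rel_interior (convex hull D)"
proof -
  obtain D where D: "D \<subseteq> C \<and> p \<in> convex hull D"
    and D_min: "\<And>E. E \<subseteq> C \<and> p \<in> convex hull E \<Longrightarrow> card D \<le> card E"
    using ex_has_least_nat[of "\<lambda>E. E \<subseteq> C \<and> p \<in> convex hull E" C card] assms by auto
  have finD: "finite D"
    using D assms finite_subset by blast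
  obtain S where S: "finite S" "S \<subseteq> D" "int (card S) \<le> aff_dim D + 1" "p \<in> convex hull S"
    using D unfolding caratheodory_aff_dim[of D] by auto
  have "card D \<le> card S"
    using S D by (intro D_min) auto
  then have ind: "\<not> affine_dependent D"
    using S(3) aff_dim_le_card[OF finD] finD by (auto simp: affine_independent_iff_card)
  obtain u where u: "\<forall>x\<in>D. 0 \<le> u x" "sum u D = 1" "(\<Sum>x\<in>D. u x *\<^sub>R x) = p"
    using D finD by (auto simp: convex_hull_finite)
  have "0 < u x" if x: "x \<in> D" for x
  proof (rule ccontr)
    assume "\<not> 0 < u x"
    then have "u x = 0"
      using u(1) x by force
    then have "sum u (D - {x}) = 1" "(\<Sum>y\<in>D - {x}. u y *\<^sub>R y) = p"
      using u(2,3) finD x by (simp_all add: sum_diff1)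
    then have "p \<in> convex hull (D - {x})"
      using u(1) finD by (auto simp: convex_hull_finite)
    then have "card D \<le> card (D - {x})"
      using D by (intro D_min) auto
    then show False
      using card_Diff1_less[OF finD x] by simp
  qed
  then have "p \<in> rel_interior (convex hull D)"
    using u(2,3) by (auto simp: rel_interior_convex_hull_explicit[OF ind])
  then show thesis
    using that D ind by blast
qed

text \<open>Codimension is subadditive under intersection; the inequality is rearranged to avoid
  subtraction of naturals.\<close>

lemma dim_Inter_subspaces:
  fixes V :: "'i \<Rightarrow> 'a::euclidean_space set"
  assumes "finite I" "\<And>i. i \<in> I \<Longrightarrow> subspace (V i)"
  shows "(\<Sum>i\<in>I. dim (V i)) + DIM('a) \<le> dim (\<Inter>i\<in>I. V i) + card I * DIM('a)"
  using assms
proof (induction I rule: finite_induct)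
  case (insert i I)
  let ?W = "\<Inter>i\<in>I. V i"
  have "subspace ?W"
    using insert.prems by (intro subspace_Inter) auto
  then have "dim {x + y |x y. x \<in> V i \<and> y \<in> ?W} + dim (V i \<inter> ?W) = dim (V i) + dim ?W"
    using insert.prems by (intro dim_sums_Int) auto
  moreover have "dim {x + y |x y. x \<in> V i \<and> y \<in> ?W} \<le> DIM('a)"
    by (rule dim_subset_UNIV)
  ultimately show ?case
    using insert by simp
qed simp

text \<open>The directions along which \<open>p\<close> can move inside all the affine hulls form the zero space, so
  the codimensions of the affine hulls add up to at least the dimension of the space.\<close>

lemma sum_card_simplices_extreme_point:
  fixes D :: "'i \<Rightarrow> 'a::euclidean_space set"
  assumes I: "finite I"
    and ind: "\<And>i. i \<in> I \<Longrightarrow> \<not> affine_dependent (D i)"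
    and rel: "\<And>i. i \<in> I \<Longrightarrow> p \<in> rel_interior (convex hull D i)"
    and ext: "p extreme_point_of (\<Inter>i\<in>I. convex hull D i)"
  shows "(\<Sum>i\<in>I. card (D i)) + DIM('a) \<le> card I * (DIM('a) + 1)"
proof -
  define V where "V i = (\<lambda>x. x - p) ` (affine hull D i)" for i
  have pA: "p \<in> affine hull D i" if "i \<in> I" for i
    using rel[OF that] rel_interior_subset convex_hull_subset_affine_hull by blast
  have sub: "subspace (V i)" if "i \<in> I" for i
    unfolding V_def using pA[OF that] by (intro affine_diffs_subspace_subtract) auto
  have dimV: "card (D i) = dim (V i) + 1" if "i \<in> I" for i
    using aff_dim_dim_affine_diffs[OF affine_affine_hull pA[OF that]] ind[OF that]
    by (simp add: V_def affine_independent_iff_card)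
  have "v = 0" if v: "v \<in> (\<Inter>i\<in>I. V i)" for v
  proof (rule ccontr)
    assume "v \<noteq> 0"
    have "\<exists>e>0. ball p e \<inter> affine hull D i \<subseteq> convex hull D i" if "i \<in> I" for i
      using rel[OF that] by (simp add: mem_rel_interior_ball)
    then obtain e where e: "\<And>i. i \<in> I \<Longrightarrow> e i > 0"
      "\<And>i. i \<in> I \<Longrightarrow> ball p (e i) \<inter> affine hull D i \<subseteq> convex hull D i"
      by metis
    \<comment> \<open>The displacement \<open>t * norm v\<close> is at most half of every radius
      \<open>e i\<close>; the inserted 1 keeps the minimum defined for empty
      \<open>I\<close>.\<close>
    define t where "t = Min (insert 1 (e ` I)) / (2 * norm v)"
    have "Min (insert 1 (e ` I)) > 0"
      using I e(1) by simp
    then have t: "t > 0"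
      using \<open>v \<noteq> 0\<close> by (simp add: t_def)
    have t_less: "t * norm v < e i" if "i \<in> I" for i
    proof -
      have "Min (insert 1 (e ` I)) \<le> e i"
        using I that by (intro Min_le) auto
      then show ?thesis
        using \<open>v \<noteq> 0\<close> e(1)[OF that] by (simp add: t_def)
    qed
    have mem: "p + s *\<^sub>R v \<in> (\<Inter>i\<in>I. convex hull D i)" if s: "\<bar>s\<bar> = t" for s
    proof
      fix i assume i: "i \<in> I"
      have "s *\<^sub>R v \<in> V i"
        using v i sub[OF i] by (simp add: subspace_scale)
      then have "p + s *\<^sub>R v \<in> affine hull D i"
        by (auto simp: V_def)
      moreover have "p + s *\<^sub>R v \<in> ball p (e i)"
        using t_less[OF i] s by (simp add: dist_norm)
      ultimately show "p + s *\<^sub>R v \<in> convex hull D i"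
        using e(2)[OF i] by blast
    qed
    have "p = midpoint (p + t *\<^sub>R v) (p + (- t) *\<^sub>R v)"
      by (simp add: midpoint_def algebra_simps flip: scaleR_add_left)
    moreover have "p + t *\<^sub>R v \<noteq> p + (- t) *\<^sub>R v"
      using t \<open>v \<noteq> 0\<close> by (simp add: scaleR_cancel_right eq_neg_iff_add_eq_0 flip: scaleR_add_left)
    ultimately have "p \<in> open_segment (p + t *\<^sub>R v) (p + (- t) *\<^sub>R v)"
      by (metis midpoint_in_open_segment)
    then show False
      using ext mem[of t] mem[of "- t"] t unfolding extreme_point_of_def by auto
  qed
  then have "dim (\<Inter>i\<in>I. V i) = 0"
    by (auto simp: dim_eq_0)
  then have "(\<Sum>i\<in>I. dim (V i)) + DIM('a) \<le> card I * DIM('a)"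
    using dim_Inter_subspaces[of I V, OF I sub] by linarith
  moreover have "(\<Sum>i\<in>I. card (D i)) = (\<Sum>i\<in>I. dim (V i)) + card I"
    by (simp add: dimV sum_Suc)
  ultimately show ?thesis
    by simp
qed

section \<open>Tverberg points in complementary simplices\<close>

lemma tverberg_point_in_complementary_simplex:
  fixes X :: "(real ^ 'd::{finite,linorder}) set"
  assumes X: "finite X" "card X = CARD('d)^2 + CARD('d) + 1"
  obtains Q \<Q> p where "Q \<subseteq> X" "card Q = CARD('d)^2" "tverberg_partition CARD('d) Q \<Q>"
    "is_tverberg_point p \<Q>" "p \<in> convex hull (X - Q)"
proof -
  have bounds: "CARD('d) * (DIM((real, 'd) vec) + 1) < card X"
    "card X \<le> CARD('d option) * (DIM((real, 'd) vec) + 1)"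
    using X(2) by (simp_all add: power2_eq_square)
  obtain g :: "(real, 'd) vec \<Rightarrow> 'd option" and p0 where
    p0: "\<And>c. p0 \<in> convex hull {x\<in>X. g x = c}"
    and small: "\<And>c. card {x\<in>X. g x = c} \<le> DIM((real, 'd) vec) + 1"
    by (rule balanced_tverberg[OF X(1) bounds]) (rule that)
  define C where "C c = {x\<in>X. g x = c}" for c
  have finC: "finite (C c)" for c
    using X(1) by (simp add: C_def)
  have "compact (\<Inter>c. convex hull C c)"
    using finC by (intro compact_Inter) (auto simp: compact_convex_hull finite_imp_compact)
  moreover have "(\<Inter>c. convex hull C c) \<noteq> {}"
    using p0 by (auto simp: C_def)
  ultimately obtain p where p: "is_lex_min p (\<Inter>c. convex hull C c)"
    by (rule lex_min_exists)
  obtain j where j: "is_lex_min p (\<Inter>c\<in>-{j}. convex hull C c)"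
    using lex_min_helly[OF _ _ p] by auto
  have pC: "p \<in> convex hull C c" for c
    using p by (auto simp: is_lex_min_def)
  have "\<exists>D\<subseteq>C c. \<not> affine_dependent D \<and> p \<in> rel_interior (convex hull D)" for c
    using minimal_simplex_containing[OF finC pC] by metis
  then obtain D where D: "\<And>c. D c \<subseteq> C c" "\<And>c. \<not> affine_dependent (D c)"
    "\<And>c. p \<in> rel_interior (convex hull D c)"
    by metis
  have pD: "p \<in> convex hull D c" for c
    using D(3) rel_interior_subset by blast
  \<comment> \<open>Any sets between \<open>D c\<close> and \<open>C c\<close> give an intersection
    that contains \<open>p\<close> and lies inside the one minimised at \<open>p\<close>. This
    applies to \<open>D\<close> itself and later to the parts of \<open>Q\<close>.\<close>
  have lex_min_between: "is_lex_min p (\<Inter>c\<in>-{j}. convex hull E c)"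
    if "\<And>c. D c \<subseteq> E c" "\<And>c. E c \<subseteq> C c" for E
  proof -
    have "p \<in> convex hull E c" for c
      using pD that(1) hull_mono by blast
    moreover have "(\<Inter>c\<in>-{j}. convex hull E c) \<subseteq> (\<Inter>c\<in>-{j}. convex hull C c)"
      using that(2) by (intro INF_mono) (use hull_mono in blast)
    ultimately show ?thesis
      using j by (auto simp: is_lex_min_def)
  qed
  have card_I: "card (-{j}) = CARD('d)"
    by (simp add: Compl_eq_Diff_UNIV card_Diff_singleton)
  have "(\<Sum>c\<in>-{j}. card (D c)) + CARD('d) \<le> CARD('d) * (CARD('d) + 1)"
    using sum_card_simplices_extreme_point[of "-{j}" D p] D
      lex_min_extreme_point[OF lex_min_between[of D]] card_I by simp
  then have "card (\<Union>c\<in>-{j}. D c) \<le> CARD('d)^2"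
    using card_UN_le[of "-{j}" D] by (simp add: power2_eq_square)
  \<comment> \<open>Balancing pays off here: the class \<open>C j\<close> has at most
    \<open>CARD('d) + 1\<close> points.\<close>
  moreover have "CARD('d)^2 \<le> card (X - C j)"
    using X small[of j] finC[of j] by (simp add: C_def card_Diff_subset)
  moreover have "(\<Union>c\<in>-{j}. D c) \<subseteq> X - C j"
    using D(1) by (fastforce simp: C_def)
  ultimately obtain Q where Q: "(\<Union>c\<in>-{j}. D c) \<subseteq> Q" "Q \<subseteq> X - C j" "card Q = CARD('d)^2"
    using exists_subset_between X(1) by (metis finite_Diff)
  \<comment> \<open>The value at \<open>j\<close> is a filler that keeps \<open>E\<close> between
    \<open>D\<close> and \<open>C\<close> and its values disjoint for all indices; only the other
    indices become parts.\<close>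
  define E where "E c = (if c = j then C j else Q \<inter> C c)" for c
  have DE: "D c \<subseteq> E c" for c
    using D(1) Q(1) by (auto simp: E_def)
  have ne: "E c \<noteq> {}" for c
    using pD DE by (metis convex_hull_empty empty_iff subset_empty)
  have disj: "E c \<inter> E c' = {}" if "c \<noteq> c'" for c c'
    using that by (auto simp: E_def C_def)
  define \<Q> where "\<Q> = E ` (-{j})"
  have "inj_on E (-{j})"
  proof (rule inj_onI)
    fix a b assume "E a = E b"
    then show "a = b"
      using disj[of a b] ne[of b] by auto
  qed
  then have "card \<Q> = CARD('d)"
    using card_I by (simp add: \<Q>_def card_image)
  moreover have "partition_on Q \<Q>"
    unfolding partition_on_def
  proof (intro conjI)
    show "\<Union>\<Q> = Q"
      using Q(2) by (auto simp: \<Q>_def E_def C_def)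
    show "disjoint \<Q>"
    proof (rule disjointI)
      fix A B assume "A \<in> \<Q>" "B \<in> \<Q>" "A \<noteq> B"
      then obtain a b where "A = E a" "B = E b" "a \<noteq> b"
        by (auto simp: \<Q>_def)
      then show "A \<inter> B = {}"
        by (simp add: disj)
    qed
    show "{} \<notin> \<Q>"
      using ne by (auto simp: \<Q>_def)
  qed
  moreover have "is_tverberg_point p \<Q>"
    using lex_min_between[of E] DE by (auto simp: is_tverberg_point_def \<Q>_def E_def)
  moreover from this have "(\<Inter>X\<in>\<Q>. convex hull X) \<noteq> {}"
    by (auto simp: is_tverberg_point_def is_lex_min_def)
  moreover have "p \<in> convex hull (X - Q)"
  proof -
    have "C j \<subseteq> X - Q"
      using Q(2) by (auto simp: C_def)
    then show ?thesis
      using pC hull_mono by blast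
  qed
  ultimately show thesis
    using Q that[of Q \<Q> p] by (auto simp: tverberg_partition_def)
qed

text \<open>An affine hull of smaller dimension would put \<open>S\<close> into a hyperplane, so
  \<open>S\<close> is affinely independent.\<close>

lemma general_position_simplex:
  fixes P :: "(real ^ 'd) set"
  assumes "general_position P" "S \<subseteq> P" "card S = CARD('d) + 1"
  shows "int CARD('d) simplex (convex hull S)"
proof -
  have "finite S"
    using assms(3) by (metis add_gr_0 card_gt_0_iff zero_less_one)
  have "\<not> aff_dim S < DIM(real ^ 'd)"
    using aff_lowdim_subset_hyperplane[of S] assms unfolding general_position_def by metis
  then have "\<not> affine_dependent S"
    using \<open>finite S\<close> aff_dim_le_card[OF \<open>finite S\<close>] assms(3)
    by (simp add: affine_independent_iff_card)
  then show ?thesis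
    using assms(3) by (auto simp: simplex_def)
qed

section \<open>Averaging\<close>

text \<open>The loss in the averaging is bounded independently of \<open>n\<close>. Replacing
  \<open>n choose k\<close> by \<open>n - q choose k\<close> costs a factor
  \<open>(q + k) ^ k\<close>, since \<open>n * k \<le> (n - q) * (q + k)\<close>; counting pairs of
  disjoint subsets costs \<open>q + k choose q\<close>.\<close>

lemma binomial_product_le:
  fixes n q k :: nat
  assumes n: "q + k \<le> n" and k: "0 < k"
  shows "(n choose q) * (n choose k) \<le> (q + k) ^ (2 * k) * (n choose (q + k))"
proof -
  have "real (n choose k) \<le> real n ^ k"
    using n by (metis binomial_le_pow add_leD2 of_nat_le_iff of_nat_power)
  also have "\<dots> \<le> (real (n - q) / real k * real (q + k)) ^ k"
  proof (rule power_mono)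
    have "real q * real (q + k) \<le> real q * real n"
      using n by (intro mult_left_mono) auto
    then have "real n * real k \<le> real (n - q) * real (q + k)"
      using n by (simp add: of_nat_diff algebra_simps)
    then show "real n \<le> real (n - q) / real k * real (q + k)"
      using k by (simp add: field_simps)
  qed simp
  also have "\<dots> \<le> real (n - q choose k) * real (q + k) ^ k"
    unfolding power_mult_distrib using n by (intro mult_right_mono binomial_ge_n_over_k_pow_k) auto
  finally have "n choose k \<le> (n - q choose k) * (q + k) ^ k"
    by (simp only: of_nat_le_iff flip: of_nat_mult of_nat_power)
  then have "(n choose q) * (n choose k) \<le> (n choose q) * (n - q choose k) * (q + k) ^ k"
    by simp
  also have "(n choose q) * (n - q choose k) = (n choose (q + k)) * (q + k choose q)"
    using choose_mult[of q "q + k" n] n by simp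
  also have "q + k choose q \<le> (q + k) ^ k"
    using binomial_symmetric[of q "q + k"] binomial_le_pow[of k "q + k"] by simp
  finally show ?thesis
    by (simp add: power_mult power2_eq_square power_mult_distrib mult_ac)
qed

lemma ex_large_fibre:
  fixes f :: "'a \<Rightarrow> 'b"
  assumes "finite A" "finite B" "f ` A \<subseteq> B" "B \<noteq> {}"
  obtains b where "b \<in> B" "card A \<le> card B * card {a\<in>A. f a = b}"
proof -
  have "card A = (\<Sum>b\<in>B. card {a\<in>A. f a = b})"
    using sum.group[OF assms(1,2), of f "\<lambda>_. 1::nat"] assms(3) by simp
  moreover have "Max ((\<lambda>b. card {a\<in>A. f a = b}) ` B) \<in> (\<lambda>b. card {a\<in>A. f a = b}) ` B"
    using assms(2,4) by (intro Max_in) auto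
  then obtain b where "b \<in> B" "Max ((\<lambda>b. card {a\<in>A. f a = b}) ` B) = card {a\<in>A. f a = b}"
    by (rule imageE)
  moreover from this have "card {a\<in>A. f a = b'} \<le> card {a\<in>A. f a = b}" if "b' \<in> B" for b'
    using Max_ge[of "(\<lambda>b. card {a\<in>A. f a = b}) ` B" "card {a\<in>A. f a = b'}"] assms(2) that by simp
  ultimately show thesis
    using that sum_bounded_above[of B "\<lambda>b. card {a\<in>A. f a = b}"] by auto
qed

theorem mainTheorem1:
  "\<exists>c::real. c > 0 \<and>
     (\<forall>(n::nat) (P :: (real ^ 'd::{finite,linorder}) set).
        finite P \<and> card P = n \<and> n \<ge> CARD('d)^2 + CARD('d) + 1 \<and> general_position P \<longrightarrow>
        (\<exists>\<Delta> \<S>. int CARD('d) simplex \<Delta> \<and> spanned_by \<Delta> P \<and>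
           \<S> \<subseteq> {Q. Q \<subseteq> P \<and> card Q = CARD('d)^2} \<and>
           real (card \<S>) \<ge> c * real (n choose (CARD('d)^2)) \<and>
           (\<forall>Q\<in>\<S>. \<exists>\<Q> p. tverberg_partition CARD('d) Q \<Q> \<and>
              is_tverberg_point p \<Q> \<and> p \<in> \<Delta>)))"
proof -
  define q k where "q = CARD('d)^2" and "k = CARD('d) + 1"
  define N where "N = (q + k) ^ (2 * k)"
  define c where "c = 1 / real N"
  have "N > 0"
    unfolding N_def by (rule zero_less_power) (simp add: k_def)
  then have "c > 0"
    by (simp add: c_def)
  moreover have "\<exists>\<Delta> \<S>. int CARD('d) simplex \<Delta> \<and> spanned_by \<Delta> P \<and>
           \<S> \<subseteq> {Q. Q \<subseteq> P \<and> card Q = CARD('d)^2} \<and>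
           real (card \<S>) \<ge> c * real (n choose (CARD('d)^2)) \<and>
           (\<forall>Q\<in>\<S>. \<exists>\<Q> p. tverberg_partition CARD('d) Q \<Q> \<and>
              is_tverberg_point p \<Q> \<and> p \<in> \<Delta>)"
    if P: "finite P" "card P = n" "q + k \<le> n" "general_position P" for n and P :: "(real, 'd) vec set"
  proof -
    define T where "T m = {S. S \<subseteq> P \<and> card S = m}" for m
    have finT: "finite (T m)" for m
      using P(1) by (simp add: T_def)
    have cardT: "card (T m) = n choose m" for m
      using n_subsets[OF P(1)] P(2) by (simp add: T_def)
    have "\<exists>Q\<subseteq>X. card Q = q \<and> (\<exists>\<Q> p. tverberg_partition CARD('d) Q \<Q> \<and>
        is_tverberg_point p \<Q> \<and> p \<in> convex hull (X - Q))" if "X \<in> T (q + k)" for X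
    proof -
      have "finite X" "card X = CARD('d)^2 + CARD('d) + 1"
        using that P(1) finite_subset by (auto simp: T_def q_def k_def)
      then show ?thesis
        unfolding q_def by (rule tverberg_point_in_complementary_simplex) blast
    qed
    then obtain Q where Q: "\<And>X. X \<in> T (q + k) \<Longrightarrow> Q X \<subseteq> X \<and> card (Q X) = q \<and>
        (\<exists>\<Q> p. tverberg_partition CARD('d) (Q X) \<Q> \<and>
          is_tverberg_point p \<Q> \<and> p \<in> convex hull (X - Q X))"
      by metis
    \<comment> \<open>Each \<open>X\<close> is assigned the vertex set of its simplex; the
      pigeonhole principle then fixes a popular vertex set \<open>S\<close>.\<close>
    have "(\<lambda>X. X - Q X) ` T (q + k) \<subseteq> T k"
    proof (clarify)
      fix X assume X: "X \<in> T (q + k)"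
      then have "finite X"
        using P(1) finite_subset by (auto simp: T_def)
      then show "X - Q X \<in> T k"
        using X Q[OF X] by (auto simp: T_def card_Diff_subset finite_subset)
    qed
    moreover have "n choose k > 0"
      using P(3) by simp
    then have "T k \<noteq> {}"
      using cardT by (metis card.empty less_irrefl)
    ultimately obtain S where S: "S \<in> T k"
      "card (T (q + k)) \<le> card (T k) * card {X\<in>T (q + k). X - Q X = S}"
      using ex_large_fibre[of "T (q + k)" "T k" "\<lambda>X. X - Q X"] finT by blast
    let ?F = "{X\<in>T (q + k). X - Q X = S}"
    have F_eq: "Q X \<union> S = X" if "X \<in> ?F" for X
      using Q[of X] that by auto
    \<comment> \<open>Once \<open>S\<close> is fixed, \<open>X\<close> is recovered from
      \<open>Q X\<close>, so the sets \<open>Q X\<close> are as numerous as the sets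
      \<open>X\<close>.\<close>
    have "inj_on Q ?F"
    proof (rule inj_onI)
      fix X Y assume XY: "X \<in> ?F" "Y \<in> ?F" "Q X = Q Y"
      show "X = Y"
        using F_eq[OF XY(1)] F_eq[OF XY(2)] XY(3) by argo
    qed
    then have card_eq: "card (Q ` ?F) = card ?F"
      by (rule card_image)
    \<comment> \<open>Combined with the pigeonhole bound, the factor \<open>n choose k\<close>
      cancels, leaving the constant \<open>N\<close>.\<close>
    have "(n choose q) * (n choose k) \<le> N * (n choose (q + k))"
      unfolding N_def using P(3) by (intro binomial_product_le) (auto simp: k_def)
    also have "\<dots> \<le> N * ((n choose k) * card ?F)"
      using S(2) unfolding cardT by (rule mult_left_mono) simp
    finally have "(n choose q) * (n choose k) \<le> (N * card ?F) * (n choose k)"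
      by (simp add: mult_ac)
    then have "n choose q \<le> N * card ?F"
      using \<open>n choose k > 0\<close> by (simp only: mult_le_cancel2)
    then have "real (n choose q) \<le> real N * real (card ?F)"
      by (simp only: of_nat_le_iff flip: of_nat_mult)
    then have "c * real (n choose q) \<le> real (card (Q ` ?F))"
      unfolding card_eq c_def using \<open>N > 0\<close> by (simp add: pos_divide_le_eq mult.commute)
    moreover have "Q X \<subseteq> P \<and> card (Q X) = q" if "X \<in> ?F" for X
      using Q[of X] that by (auto simp: T_def)
    then have "Q ` ?F \<subseteq> {Q. Q \<subseteq> P \<and> card Q = q}"
      by blast
    moreover have "int CARD('d) simplex (convex hull S)"
      using general_position_simplex[OF P(4)] S(1) by (simp add: T_def k_def)
    moreover have "spanned_by (convex hull S) P"
      using S(1) by (auto simp: spanned_by_def T_def k_def)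
    moreover have "\<forall>R\<in>Q ` ?F. \<exists>\<Q> p. tverberg_partition CARD('d) R \<Q> \<and>
        is_tverberg_point p \<Q> \<and> p \<in> convex hull S"
      using Q by auto
    ultimately show ?thesis
      unfolding q_def by blast
  qed
  ultimately show ?thesis
    unfolding q_def k_def by (intro exI[of _ c]) (auto simp: add.assoc)
qed

end
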